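(* Let $p>0$ and let $A=(a_{n,k})_{n,k\ge0}$ be given by $a_{n,n}=1$ and $a_{n,k}=0$ for $k\ne n$. Then for every $n$ the row $(a_{n,k})_{k=0}^{\infty}$ belongs to $NMCS$, but the estimate $$\left\Vert T_{n,A}^{p}f\right\Vert\le K\sum_{k=0}^{\infty}a_{n,k}\,\bigl(E_{k}(f)\bigr)^{p},$$ which for this matrix is equivalent to an estimate of the form $\Vert S_nf-f\Vert\le K' E_n(f)$, does not hold in general: there is no constant $K$ such that it holds for all $f\in C_{2\pi}$ and all $n\ge 0$.
   Context: $C_{2\pi}$ is the class of $2\pi$-periodic continuous real-valued functions, with the norm $\Vert g\Vert=\sup_{t\in[-\pi,\pi]}|g(t)|$. $S_kf$ denotes the $k$-th partial sum of the trigonometric Fourier series of $f$. $T_{n,A}^{p}f(x)=\sum_{k=0}^{\infty}a_{n,k}|S_kf(x)-f(x)|^{p}$. $E_k(f)=\inf_{t_k}\Vert f-t_k\Vert$, the infimum being over trigonometric polynomials $t_k$ of order at most $k$. A sequence $(a_k)$ of nonnegative numbers belongs to $NMCS$ if $\sum_{k=1}^{\infty}a_k<\infty$ and $ka_k\to0$ as $k\to\infty$. *)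

theory Defs
  imports "HOL-Analysis.Analysis"
begin

definition C2pi :: "(real \<Rightarrow> real) set" where
  "C2pi = {f. continuous_on UNIV f \<and> (\<forall>x. f (x + 2 * pi) = f x)}"

definition sup_norm :: "(real \<Rightarrow> real) \<Rightarrow> real" where
  "sup_norm g = (SUP t\<in>{-pi..pi}. \<bar>g t\<bar>)"

definition fourier_cos :: "(real \<Rightarrow> real) \<Rightarrow> nat \<Rightarrow> real" where
  "fourier_cos f j = (1 / pi) * integral {-pi..pi} (\<lambda>t. f t * cos (real j * t))"

definition fourier_sin :: "(real \<Rightarrow> real) \<Rightarrow> nat \<Rightarrow> real" where
  "fourier_sin f j = (1 / pi) * integral {-pi..pi} (\<lambda>t. f t * sin (real j * t))"

definition fourier_sum :: "nat \<Rightarrow> (real \<Rightarrow> real) \<Rightarrow> real \<Rightarrow> real" where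
  "fourier_sum k f x = fourier_cos f 0 / 2 +
     (\<Sum>j=1..k. fourier_cos f j * cos (real j * x) + fourier_sin f j * sin (real j * x))"

(* The j = 0 term contributes the constant a 0, since sin 0 = 0. *)
definition trig_polys :: "nat \<Rightarrow> (real \<Rightarrow> real) set" where
  "trig_polys k =
     {t. \<exists>a b. t = (\<lambda>x. \<Sum>j\<le>k. a j * cos (real j * x) + b j * sin (real j * x))}"

definition best_approx :: "nat \<Rightarrow> (real \<Rightarrow> real) \<Rightarrow> real" where
  "best_approx k f = (INF t\<in>trig_polys k. sup_norm (\<lambda>x. f x - t x))"

(* The series is meaningful only where it converges, since suminf is total;
   for rows of finite support it is a finite sum. *)
definition strong_mean ::
  "real \<Rightarrow> (nat \<Rightarrow> nat \<Rightarrow> real) \<Rightarrow> nat \<Rightarrow> (real \<Rightarrow> real) \<Rightarrow> real \<Rightarrow> real" where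
  "strong_mean p A n f x = (\<Sum>k. A n k * \<bar>fourier_sum k f x - f x\<bar> powr p)"

definition NMCS :: "(nat \<Rightarrow> real) set" where
  "NMCS = {a. (\<forall>k. 0 \<le> a k) \<and> summable (\<lambda>k. a (Suc k)) \<and>
              (\<lambda>k. real k * a k) \<longlonglongrightarrow> 0}"

definition strong_estimate ::
  "real \<Rightarrow> (nat \<Rightarrow> nat \<Rightarrow> real) \<Rightarrow> real \<Rightarrow> (real \<Rightarrow> real) \<Rightarrow> nat \<Rightarrow> bool" where
  "strong_estimate p A K f n \<longleftrightarrow>
     sup_norm (strong_mean p A n f) \<le> K * (\<Sum>k. A n k * best_approx k f powr p)"

end

(* Since E_n(f) <= ||f||, it suffices to find functions f that are bounded uniformly in n while
   |S_n f(0) - f(0)| is unbounded.  Fejer's polynomials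
     sum_{k=1}^n (cos((n-k)x) - cos((n+k)x)) / k  =  2 sin(nx) sum_{k=1}^n sin(kx)/k
   do this: they are bounded by 6 and vanish at 0, and S_n keeps exactly the terms with the
   positive sign, whose value at 0 is the harmonic number H_n.  The bound on the sine sum comes
   from splitting it at k = 1/s, where s = |sin(x/2)|: the terms up to there are at most 2s each,
   and Abel summation bounds the rest by 1. *)
theory Submission
  imports Defs
begin

section \<open>The supremum norm and best approximation\<close>

text \<open>Compactness of the period interval turns the supremum into a maximum. Later bounds argue
  at the maximiser and so avoid the boundedness side conditions of \<open>SUP\<close>.\<close>

lemma sup_norm_attained:
  assumes "continuous_on UNIV g"
  obtains t where "t \<in> {-pi..pi}" "sup_norm g = \<bar>g t\<bar>" "\<And>s. s \<in> {-pi..pi} \<Longrightarrow> \<bar>g s\<bar> \<le> \<bar>g t\<bar>"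
proof -
  have "continuous_on {-pi..pi} (\<lambda>t. \<bar>g t\<bar>)"
    using assms by (intro continuous_intros) (auto intro: continuous_on_subset)
  then obtain t where t: "t \<in> {-pi..pi}" "\<And>s. s \<in> {-pi..pi} \<Longrightarrow> \<bar>g s\<bar> \<le> \<bar>g t\<bar>"
    using continuous_attains_sup[of "{-pi..pi}" "\<lambda>t. \<bar>g t\<bar>"] by auto
  moreover have "sup_norm g = \<bar>g t\<bar>"
    unfolding sup_norm_def using t by (intro cSup_eq_maximum) auto
  ultimately show thesis using that by blast
qed

lemma sup_norm_nonneg: "continuous_on UNIV g \<Longrightarrow> 0 \<le> sup_norm g"
  by (metis sup_norm_attained abs_ge_zero)

lemma abs_le_sup_norm:
  assumes "continuous_on UNIV g" "t \<in> {-pi..pi}"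
  shows "\<bar>g t\<bar> \<le> sup_norm g"
  by (metis sup_norm_attained assms)

lemma sup_norm_le:
  assumes "continuous_on UNIV g" "\<And>t. \<bar>g t\<bar> \<le> c"
  shows "sup_norm g \<le> c"
  by (metis sup_norm_attained assms)

text \<open>The power map is monotone on nonnegative reals, so the same point maximises both
  functions.\<close>

lemma sup_norm_abs_powr:
  assumes "continuous_on UNIV g" "p \<ge> 0"
  shows "sup_norm (\<lambda>x. \<bar>g x\<bar> powr p) = sup_norm g powr p"
proof -
  obtain t where t: "t \<in> {-pi..pi}" "sup_norm g = \<bar>g t\<bar>"
      "\<And>s. s \<in> {-pi..pi} \<Longrightarrow> \<bar>g s\<bar> \<le> \<bar>g t\<bar>"
    using sup_norm_attained[OF assms(1)] by blast
  have "sup_norm (\<lambda>x. \<bar>g x\<bar> powr p) = \<bar>g t\<bar> powr p"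
    unfolding sup_norm_def using t assms by (intro cSup_eq_maximum) (auto intro!: powr_mono2)
  with t show ?thesis by simp
qed

lemma continuous_on_trig_poly: "t \<in> trig_polys k \<Longrightarrow> continuous_on UNIV t"
  unfolding trig_polys_def by (auto intro!: continuous_intros)

lemma zero_in_trig_polys: "(\<lambda>x. 0) \<in> trig_polys k"
  unfolding trig_polys_def by (auto intro!: exI[of _ "\<lambda>_. 0"])

lemma best_approx_nonneg:
  assumes "continuous_on UNIV f"
  shows "0 \<le> best_approx k f"
  unfolding best_approx_def
  using zero_in_trig_polys
  by (intro cINF_greatest sup_norm_nonneg continuous_intros assms continuous_on_trig_poly) auto

text \<open>The zero polynomial competes in the infimum. Nonnegativity of the norms supplies the
  lower bound without which a real \<open>INF\<close> says nothing.\<close>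

lemma best_approx_le_sup_norm:
  assumes "continuous_on UNIV f"
  shows "best_approx k f \<le> sup_norm f"
proof -
  have "bdd_below ((\<lambda>t. sup_norm (\<lambda>x. f x - t x)) ` trig_polys k)"
    by (intro bdd_belowI2[of _ 0] sup_norm_nonneg continuous_intros assms continuous_on_trig_poly)
  from cINF_lower[OF this zero_in_trig_polys] show ?thesis
    unfolding best_approx_def by simp
qed

lemma continuous_on_fourier_sum: "continuous_on UNIV (fourier_sum n f)"
  unfolding fourier_sum_def[abs_def] by (intro continuous_intros)

section \<open>Fejer's polynomials\<close>

lemma abs_sin_mult_le: "\<bar>sin (real k * x)\<bar> \<le> real k * \<bar>sin x\<bar>"
proof (induction k)
  case (Suc k)
  have "\<bar>sin (real (Suc k) * x)\<bar> = \<bar>sin (real k * x) * cos x + cos (real k * x) * sin x\<bar>"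
    by (simp add: algebra_simps sin_add)
  also have "\<dots> \<le> \<bar>sin (real k * x)\<bar> * \<bar>cos x\<bar> + \<bar>cos (real k * x)\<bar> * \<bar>sin x\<bar>"
    by (metis abs_mult abs_triangle_ineq)
  also have "\<dots> \<le> \<bar>sin (real k * x)\<bar> * 1 + 1 * \<bar>sin x\<bar>"
    by (intro add_mono mult_mono) auto
  finally show ?case using Suc by (simp add: algebra_simps)
qed simp

text \<open>Multiplied by 2 sin(x/2), each sin(kx) becomes a difference of consecutive bounded
  cosines; Abel summation against the decreasing weights 1/k then leaves only the size of the first
  weight.\<close>

lemma abs_sum_sin_div_tail_le:
  assumes "m \<le> n"
  shows "\<bar>sin (x/2)\<bar> * \<bar>\<Sum>k=Suc m..n. sin (real k * x) / real k\<bar> \<le> 1 / real (Suc m)"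
proof -
  define c where "c k = cos ((real k - 1/2) * x)" for k
  have c_le: "\<bar>c k\<bar> \<le> 1" for k by (simp add: c_def)
  have sin_c: "2 * sin (x/2) * sin (real k * x) = c k - c (Suc k)" for k
  proof -
    have "c k = cos (real k * x - x/2)" "c (Suc k) = cos (real k * x + x/2)"
      by (simp_all add: c_def algebra_simps)
    then show ?thesis by (simp add: cos_add cos_diff)
  qed
  \<comment> \<open>The boundary term of Abel summation is kept inside, so that passing from n to
    n+1 changes the left side only by \<open>c (n+2) * d\<close>. The bounds \<open>d\<close>
    telescope, which produces the right side.\<close>
  have abel: "\<bar>(\<Sum>k=Suc m..n. (c k - c (Suc k)) / real k) + c (Suc n) / real (Suc n)\<bar>
        \<le> 2 / real (Suc m) - 1 / real (Suc n)"
    using assms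
  proof (induction n rule: dec_induct)
    case base
    then show ?case using c_le[of "Suc m"] by (simp add: divide_right_mono)
  next
    case (step n)
    define S where "S = (\<Sum>k=Suc m..n. (c k - c (Suc k)) / real k)"
    define d where "d = 1 / real (Suc n) - 1 / real (Suc (Suc n))"
    have "d \<ge> 0" unfolding d_def by (simp add: field_simps)
    then have "\<bar>c (Suc (Suc n)) * d\<bar> \<le> d"
      using mult_right_mono[OF c_le[of "Suc (Suc n)"], of d] by (simp add: abs_mult)
    moreover have "(\<Sum>k=Suc m..Suc n. (c k - c (Suc k)) / real k)
          + c (Suc (Suc n)) / real (Suc (Suc n))
        = S + c (Suc n) / real (Suc n) - c (Suc (Suc n)) * d"
      using step.hyps unfolding S_def d_def by (simp add: algebra_simps diff_divide_distrib)
    ultimately show ?case using step.IH unfolding S_def[symmetric] d_def by linarith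
  qed
  \<comment> \<open>Dropping the boundary term costs exactly the amount 1/(n+1) subtracted in
    \<open>abel\<close>.\<close>
  have "\<bar>c (Suc n) / real (Suc n)\<bar> \<le> 1 / real (Suc n)"
    using c_le[of "Suc n"] by (simp add: divide_right_mono)
  with abel have "\<bar>\<Sum>k=Suc m..n. (c k - c (Suc k)) / real k\<bar> \<le> 2 / real (Suc m)"
    by linarith
  also have "(\<Sum>k=Suc m..n. (c k - c (Suc k)) / real k)
      = 2 * (sin (x/2) * (\<Sum>k=Suc m..n. sin (real k * x) / real k))"
    by (simp add: sum_distrib_left sin_c[symmetric] mult.assoc)
  finally show ?thesis by (simp add: abs_mult)
qed

lemma abs_sum_sin_div_le: "\<bar>\<Sum>k=1..n. sin (real k * x) / real k\<bar> \<le> 3"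
proof (cases "sin (x/2) = 0")
  case True
  have "sin (real k * x) = 0" for k
    using abs_sin_mult_le[of "2 * k" "x/2"] True by simp
  then show ?thesis by simp
next
  case False
  define s where "s = \<bar>sin (x/2)\<bar>"
  \<comment> \<open>This cut gives m s \<le> 1 \<le> (m+1) s: the first inequality controls the
    head, the second the tail.\<close>
  define m where "m = nat \<lfloor>1 / s\<rfloor>"
  have s: "s > 0" using False by (simp add: s_def)
  have "real m \<le> 1 / s" "1 / s \<le> real (Suc m)"
    using s unfolding m_def by (simp, linarith)
  then have m: "real m * s \<le> 1" "1 \<le> s * real (Suc m)"
    using s by (simp_all add: field_simps)
  \<comment> \<open>Stated for every l \<le> m, to cover both a sum that ends before the cut and the
    full head. Writing sin(kx) as sin(2k (x/2)) gives 2ks, hence 2s per term.\<close>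
  have head: "\<bar>\<Sum>k=1..l. sin (real k * x) / real k\<bar> \<le> 2" if "l \<le> m" for l
  proof -
    have "\<bar>\<Sum>k=1..l. sin (real k * x) / real k\<bar> \<le> (\<Sum>k=1..l. \<bar>sin (real k * x) / real k\<bar>)"
      by (rule sum_abs)
    also have "\<dots> \<le> (\<Sum>k=1..l. 2 * s)"
    proof (intro sum_mono)
      fix k assume "k \<in> {1..l}"
      then show "\<bar>sin (real k * x) / real k\<bar> \<le> 2 * s"
        using abs_sin_mult_le[of "2 * k" "x/2"] by (simp add: s_def field_simps)
    qed
    also have "\<dots> = 2 * (real l * s)" by simp
    also have "\<dots> \<le> 2 * (real m * s)" using that s by simp
    finally show ?thesis using m by linarith
  qed
  show ?thesis
  proof (cases "n \<le> m")
    case True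
    then show ?thesis using head[of n] by linarith
  next
    case False
    then have split: "{1..n} = {1..m} \<union> {Suc m..n}" by auto
    have "s * \<bar>\<Sum>k=Suc m..n. sin (real k * x) / real k\<bar> \<le> 1 / real (Suc m)"
      using abs_sum_sin_div_tail_le[of m n x] False unfolding s_def by linarith
    also have "\<dots> \<le> s" using m by (simp add: field_simps)
    finally have "\<bar>\<Sum>k=Suc m..n. sin (real k * x) / real k\<bar> \<le> 1"
      using s by simp
    moreover have "(\<Sum>k=1..n. sin (real k * x) / real k)
        = (\<Sum>k=1..m. sin (real k * x) / real k) + (\<Sum>k=Suc m..n. sin (real k * x) / real k)"
      unfolding split by (intro sum.union_disjoint) auto
    ultimately show ?thesis using head[of m] by linarith
  qed
qed

text \<open>Since k \<le> n, the truncated subtraction is exact; k = n contributes frequency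
  0.\<close>

definition fejer_poly :: "nat \<Rightarrow> real \<Rightarrow> real" where
  "fejer_poly n x = (\<Sum>k=1..n. (cos (real (n - k) * x) - cos (real (n + k) * x)) / real k)"

lemma fejer_poly_in_C2pi: "fejer_poly n \<in> C2pi"
proof -
  have "cos (real m * (x + 2 * pi)) = cos (real m * x)" for m x
    using cos.plus_of_nat[of "real m * x" m] by (simp add: algebra_simps)
  then show ?thesis
    unfolding C2pi_def fejer_poly_def[abs_def]
    by (simp only: mem_Collect_eq) (auto intro!: continuous_intros)
qed

lemma abs_fejer_poly_le: "\<bar>fejer_poly n x\<bar> \<le> 6"
proof -
  have "fejer_poly n x = 2 * sin (real n * x) * (\<Sum>k=1..n. sin (real k * x) / real k)"
    unfolding fejer_poly_def sum_distrib_left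
  proof (intro sum.cong refl)
    fix k assume "k \<in> {1..n}"
    then have "real (n - k) * x = real n * x - real k * x" "real (n + k) * x = real n * x + real k * x"
      by (simp_all add: of_nat_diff algebra_simps)
    then show "(cos (real (n - k) * x) - cos (real (n + k) * x)) / real k
        = 2 * sin (real n * x) * (sin (real k * x) / real k)"
      by (simp only: cos_add cos_diff) simp
  qed
  also have "\<bar>\<dots>\<bar> = 2 * (\<bar>sin (real n * x)\<bar> * \<bar>\<Sum>k=1..n. sin (real k * x) / real k\<bar>)"
    by (simp add: abs_mult)
  also have "\<dots> \<le> 2 * (1 * 3)"
    by (intro mult_left_mono mult_mono abs_sum_sin_div_le) auto
  finally show ?thesis by simp
qed

section \<open>Fourier coefficients and partial sums of Fejer's polynomials\<close>

lemma has_integral_cos_int: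
  "((\<lambda>t. cos (of_int k * t)) has_integral (if k = 0 then 2 * pi else 0)) {-pi..pi}"
proof (cases "k = 0")
  case True
  then show ?thesis using has_integral_const_real[of "1::real" "-pi" pi] by simp
next
  case False
  have "((\<lambda>t. cos (of_int k * t)) has_integral
      (sin (of_int k * pi) / of_int k - sin (of_int k * (-pi)) / of_int k)) {-pi..pi}"
    using False
    by (intro fundamental_theorem_of_calculus)
       (auto simp flip: has_real_derivative_iff_has_vector_derivative intro!: derivative_eq_intros)
  moreover have "sin (of_int k * pi) = 0"
    by (simp add: sin_zero_iff_int2)
  ultimately show ?thesis using False by simp
qed

text \<open>Product-to-sum reduces this to single cosines. The difference m - j can be negative,
  hence the integer frequencies in \<open>has_integral_cos_int\<close>.\<close>

lemma has_integral_cos_cos: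
  "((\<lambda>t. cos (real m * t) * cos (real j * t)) has_integral
     (if m = j then if j = 0 then 2 * pi else pi else 0)) {-pi..pi}"
proof -
  have "((\<lambda>t. (cos (of_int (int m - int j) * t) + cos (of_int (int m + int j) * t)) / 2)
      has_integral ((if int m - int j = 0 then 2 * pi else 0)
        + (if int m + int j = 0 then 2 * pi else 0)) / 2) {-pi..pi}"
    by (intro has_integral_divide has_integral_add has_integral_cos_int)
  moreover have "(\<lambda>t. (cos (of_int (int m - int j) * t) + cos (of_int (int m + int j) * t)) / 2)
      = (\<lambda>t. cos (real m * t) * cos (real j * t))"
    by (simp add: algebra_simps cos_add cos_diff)
  moreover have "((if int m - int j = 0 then 2 * pi else 0)
        + (if int m + int j = 0 then 2 * pi else 0)) / 2
      = (if m = j then if j = 0 then 2 * pi else pi else 0)"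
    by auto
  ultimately show ?thesis by (simp only:)
qed

text \<open>Orthogonality, term by term. Cosine coefficients suffice because the partial sum is
  evaluated only at 0; the value 2 at j = 0 offsets the halved constant term there.\<close>

lemma fourier_cos_fejer_poly:
  "fourier_cos (fejer_poly n) j = (\<Sum>k=1..n. ((if n - k = j then if j = 0 then 2 else 1 else 0)
     - (if n + k = j then if j = 0 then 2 else 1 else 0)) / real k)"
proof -
  define e where "e m = (if m = j then if j = 0 then 2 else 1 else 0 :: real)" for m
  have e: "((\<lambda>t. cos (real m * t) * cos (real j * t)) has_integral (pi * e m)) {-pi..pi}" for m
  proof -
    have "pi * e m = (if m = j then if j = 0 then 2 * pi else pi else 0)"
      by (simp add: e_def)
    then show ?thesis using has_integral_cos_cos[of m j] by simp
  qed
  have "((\<lambda>t. \<Sum>k=1..n. (cos (real (n - k) * t) * cos (real j * t)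
        - cos (real (n + k) * t) * cos (real j * t)) / real k)
      has_integral (\<Sum>k=1..n. (pi * e (n - k) - pi * e (n + k)) / real k)) {-pi..pi}"
    by (intro has_integral_sum has_integral_divide has_integral_diff e) auto
  moreover have "(\<lambda>t. \<Sum>k=1..n. (cos (real (n - k) * t) * cos (real j * t)
        - cos (real (n + k) * t) * cos (real j * t)) / real k)
      = (\<lambda>t. fejer_poly n t * cos (real j * t))"
    unfolding fejer_poly_def sum_distrib_right by (simp add: left_diff_distrib)
  ultimately have "integral {-pi..pi} (\<lambda>t. fejer_poly n t * cos (real j * t))
      = (\<Sum>k=1..n. (pi * e (n - k) - pi * e (n + k)) / real k)"
    by (simp add: integral_unique)
  also have "\<dots> = pi * (\<Sum>k=1..n. (e (n - k) - e (n + k)) / real k)"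
    by (simp add: sum_distrib_left right_diff_distrib)
  finally show ?thesis by (simp add: fourier_cos_def e_def)
qed

lemma fourier_sum_fejer_poly: "fourier_sum n (fejer_poly n) 0 = (\<Sum>k=1..n. 1 / real k)"
proof -
  define e where "e m j = (if m = j then if j = 0 then 2 else 1 else 0 :: real)" for m j :: nat
  \<comment> \<open>The value at 0 of the n-th partial sum of cos(mx): the frequency is either kept
    whole or removed.\<close>
  have e_sum: "e m 0 / 2 + (\<Sum>j=1..n. e m j) = (if m \<le> n then 1 else 0)" for m
  proof -
    have "(\<Sum>j=1..n. e m j) = (\<Sum>j=1..n. if m = j then 1 else 0)"
      by (intro sum.cong) (auto simp: e_def)
    then show ?thesis by (auto simp: e_def)
  qed
  have "fourier_sum n (fejer_poly n) 0
      = (\<Sum>k=1..n. (e (n - k) 0 - e (n + k) 0) / real k) / 2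
        + (\<Sum>j=1..n. \<Sum>k=1..n. (e (n - k) j - e (n + k) j) / real k)"
    by (simp add: fourier_sum_def fourier_cos_fejer_poly e_def)
  also have "(\<Sum>j=1..n. \<Sum>k=1..n. (e (n - k) j - e (n + k) j) / real k)
      = (\<Sum>k=1..n. \<Sum>j=1..n. (e (n - k) j - e (n + k) j) / real k)"
    by (rule sum.swap)
  also have "(\<Sum>k=1..n. (e (n - k) 0 - e (n + k) 0) / real k) / 2 + \<dots>
      = (\<Sum>k=1..n. ((e (n - k) 0 / 2 + (\<Sum>j=1..n. e (n - k) j))
          - (e (n + k) 0 / 2 + (\<Sum>j=1..n. e (n + k) j))) / real k)"
    unfolding sum_divide_distrib sum.distrib[symmetric]
    by (intro sum.cong refl)
       (simp add: sum_divide_distrib sum_subtractf add_divide_distrib diff_divide_distrib)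
  \<comment> \<open>For k \<ge> 1 the frequency n - k survives and n + k does not.\<close>
  also have "\<dots> = (\<Sum>k=1..n. 1 / real k)"
    unfolding e_sum by (intro sum.cong) auto
  finally show ?thesis .
qed

lemma harm_le_sup_norm_fejer_poly:
  "(\<Sum>k=1..n. 1 / real k) \<le> sup_norm (\<lambda>x. fourier_sum n (fejer_poly n) x - fejer_poly n x)"
proof -
  have "continuous_on UNIV (\<lambda>x. fourier_sum n (fejer_poly n) x - fejer_poly n x)"
    using fejer_poly_in_C2pi[of n]
    by (intro continuous_intros continuous_on_fourier_sum) (auto simp: C2pi_def)
  from abs_le_sup_norm[OF this, of 0]
  have "\<bar>fourier_sum n (fejer_poly n) 0 - fejer_poly n 0\<bar>
      \<le> sup_norm (\<lambda>x. fourier_sum n (fejer_poly n) x - fejer_poly n x)" by simp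
  moreover have "fejer_poly n 0 = 0" by (simp add: fejer_poly_def)
  ultimately show ?thesis by (simp add: fourier_sum_fejer_poly)
qed

section \<open>Failure of the estimate by best approximation\<close>

lemma no_uniform_fourier_sum_estimate:
  "\<not> (\<exists>K. \<forall>f\<in>C2pi. \<forall>n. sup_norm (\<lambda>x. fourier_sum n f x - f x) \<le> K * best_approx n f)"
proof
  assume "\<exists>K. \<forall>f\<in>C2pi. \<forall>n. sup_norm (\<lambda>x. fourier_sum n f x - f x) \<le> K * best_approx n f"
  then obtain K where
    K: "\<And>f n. f \<in> C2pi \<Longrightarrow> sup_norm (\<lambda>x. fourier_sum n f x - f x) \<le> K * best_approx n f"
    by blast
  have harm_le: "(harm n :: real) \<le> \<bar>K\<bar> * 6" for n
  proof -
    have cont: "continuous_on UNIV (fejer_poly n)"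
      using fejer_poly_in_C2pi by (auto simp: C2pi_def)
    have "harm n \<le> K * best_approx n (fejer_poly n)"
      using harm_le_sup_norm_fejer_poly[of n] K[OF fejer_poly_in_C2pi[of n], of n]
      by (simp add: harm_def inverse_eq_divide)
    \<comment> \<open>The sign of \<open>K\<close> is unknown, so \<open>\<bar>K\<bar>\<close> is
      used before inserting the uniform bound 6; divergence of the harmonic series then gives the
      contradiction.\<close>
    also have "\<dots> \<le> \<bar>K\<bar> * best_approx n (fejer_poly n)"
      by (intro mult_right_mono best_approx_nonneg cont) simp
    also have "\<dots> \<le> \<bar>K\<bar> * 6"
      using best_approx_le_sup_norm[OF cont] sup_norm_le[OF cont abs_fejer_poly_le]
      by (intro mult_left_mono) (auto intro: order_trans)
    finally show ?thesis .
  qed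
  have "filterlim (harm :: nat \<Rightarrow> real) at_top sequentially" by (rule harm_at_top)
  then have "\<forall>\<^sub>F n in sequentially. (harm n :: real) > \<bar>K\<bar> * 6"
    by (simp add: filterlim_at_top_dense)
  then obtain n where "(harm n :: real) > \<bar>K\<bar> * 6"
    by (auto simp: eventually_sequentially)
  with harm_le[of n] show False by simp
qed

section \<open>The diagonal matrix\<close>

lemma powr_le_mult_powr_iff:
  fixes p K s e :: real
  assumes "p > 0" "K \<ge> 0" "s \<ge> 0" "e \<ge> 0"
  shows "s powr p \<le> K powr p * e powr p \<longleftrightarrow> s \<le> K * e"
proof -
  have "K powr p * e powr p = (K * e) powr p" using assms by (simp add: powr_mult)
  then show ?thesis
    using assms powr_mono2[of p s "K * e"] powr_less_mono2[of p "K * e" s] by fastforce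
qed

text \<open>A nonzero \<open>e\<close> makes the right side strictly negative, while
  \<open>e = 0\<close> makes it 0. The resulting condition does not depend on \<open>p\<close>, so
  exponents \<open>p\<close> and 1 can be compared with the same \<open>K\<close>.\<close>

lemma powr_le_mult_powr_neg_iff:
  fixes p K s e :: real
  assumes "p > 0" "K < 0" "s \<ge> 0" "e \<ge> 0"
  shows "s powr p \<le> K * e powr p \<longleftrightarrow> s = 0 \<and> e = 0"
proof (cases "e = 0")
  case False
  then have "K * e powr p < 0" using assms by (simp add: mult_neg_pos)
  then show ?thesis using False powr_ge_zero[of s p] by linarith
qed (use assms in auto)

lemma unit_row_in_NMCS:
  assumes "a n = 1" "\<And>k. k \<noteq> n \<Longrightarrow> a k = (0::real)"
  shows "a \<in> NMCS"
proof -
  have "0 \<le> a k" for k using assms by (cases "k = n") auto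
  moreover have "summable a"
    using assms by (intro summable_finite[of "{n}"]) auto
  then have "summable (\<lambda>k. a (Suc k))" by (simp add: summable_Suc_iff)
  moreover have "\<forall>\<^sub>F k in sequentially. real k * a k = 0"
    using eventually_gt_at_top[of n] by eventually_elim (simp add: assms)
  then have "(\<lambda>k. real k * a k) \<longlonglongrightarrow> 0" by (rule tendsto_eventually)
  ultimately show ?thesis by (simp add: NMCS_def)
qed

lemma strong_estimate_unit_row:
  assumes "p > 0" "A n n = 1" "\<And>k. k \<noteq> n \<Longrightarrow> A n k = 0" "f \<in> C2pi"
  shows "strong_estimate p A K f n \<longleftrightarrow>
    sup_norm (\<lambda>x. fourier_sum n f x - f x) powr p \<le> K * best_approx n f powr p"
proof -
  \<comment> \<open>The series has a single nonzero term, so both the strong mean and the right side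
    collapse to index n.\<close>
  have row: "(\<Sum>k. A n k * g k) = g n" for g :: "nat \<Rightarrow> real"
    using suminf_finite[of "{n}" "\<lambda>k. A n k * g k"] assms by auto
  have "continuous_on UNIV (\<lambda>x. fourier_sum n f x - f x)"
    using assms by (intro continuous_intros continuous_on_fourier_sum) (auto simp: C2pi_def)
  then show ?thesis
    using assms(1) by (simp add: strong_estimate_def strong_mean_def[abs_def] row sup_norm_abs_powr)
qed

theorem mainTheorem2:
  fixes p :: real and A :: "nat \<Rightarrow> nat \<Rightarrow> real"
  assumes "p > 0"
    and "\<And>n. A n n = 1"
    and "\<And>n k. k \<noteq> n \<Longrightarrow> A n k = 0"
  shows "(\<forall>n. A n \<in> NMCS) \<and>
    (\<forall>K. \<exists>K'. \<forall>f\<in>C2pi. \<forall>n.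
       strong_estimate p A K f n \<longleftrightarrow>
       sup_norm (\<lambda>x. fourier_sum n f x - f x) \<le> K' * best_approx n f) \<and>
    (\<forall>K'. \<exists>K. \<forall>f\<in>C2pi. \<forall>n.
       strong_estimate p A K f n \<longleftrightarrow>
       sup_norm (\<lambda>x. fourier_sum n f x - f x) \<le> K' * best_approx n f) \<and>
    \<not> (\<exists>K. \<forall>f\<in>C2pi. \<forall>n. strong_estimate p A K f n)"
proof -
  define s where "s f n = sup_norm (\<lambda>x. fourier_sum n f x - f x)" for f n
  have est: "strong_estimate p A K f n \<longleftrightarrow> s f n powr p \<le> K * best_approx n f powr p"
    if "f \<in> C2pi" for K f n
    using strong_estimate_unit_row[where A = A and n = n] assms that by (simp add: s_def)
  have nonneg: "s f n \<ge> 0" "best_approx n f \<ge> 0" if "f \<in> C2pi" for f n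
    using that unfolding s_def
    by (auto simp: C2pi_def intro!: sup_norm_nonneg best_approx_nonneg continuous_intros
        continuous_on_fourier_sum)
  have nonneg_iff: "strong_estimate p A (K powr p) f n \<longleftrightarrow> s f n \<le> K * best_approx n f"
    if "K \<ge> 0" "f \<in> C2pi" for K f n
    using that nonneg assms(1) by (simp add: est powr_le_mult_powr_iff)
  \<comment> \<open>for a negative constant either estimate says that both sides vanish\<close>
  have neg_iff: "strong_estimate p A K f n \<longleftrightarrow> s f n \<le> K * best_approx n f"
    if "K < 0" "f \<in> C2pi" for K f n
    using that nonneg[of f n] assms(1) powr_le_mult_powr_neg_iff[of p K "s f n" "best_approx n f"]
      powr_le_mult_powr_neg_iff[of 1 K "s f n" "best_approx n f"]
    by (simp add: est)
  \<comment> \<open>The witness is the p-th root of \<open>K\<close> if \<open>K\<close> is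
    nonnegative, and \<open>K\<close> itself otherwise.\<close>
  have to_sup: "\<exists>K'. \<forall>f\<in>C2pi. \<forall>n. strong_estimate p A K f n \<longleftrightarrow> s f n \<le> K' * best_approx n f"
    for K
  proof (cases "K < 0")
    case True
    then show ?thesis using neg_iff by blast
  next
    case False
    then have "(K powr (1/p)) powr p = K" using assms(1) by (simp add: powr_powr)
    then show ?thesis using nonneg_iff[of "K powr (1/p)"] by (metis powr_ge_zero)
  qed
  \<comment> \<open>Conversely \<open>K' powr p\<close> serves for nonnegative \<open>K'\<close>,
    and \<open>K'\<close> itself for negative \<open>K'\<close>.\<close>
  have from_sup: "\<exists>K. \<forall>f\<in>C2pi. \<forall>n. strong_estimate p A K f n \<longleftrightarrow> s f n \<le> K' * best_approx n f"
    for K'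
    using nonneg_iff[of K'] neg_iff[of K'] by (cases "K' < 0") (blast, metis not_less)
  have "\<not> (\<exists>K. \<forall>f\<in>C2pi. \<forall>n. strong_estimate p A K f n)"
    using to_sup no_uniform_fourier_sum_estimate unfolding s_def by metis
  moreover have "A n \<in> NMCS" for n
    using assms by (intro unit_row_in_NMCS[of _ n]) auto
  ultimately show ?thesis using to_sup from_sup unfolding s_def by blast
qed

end
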